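(* For each $n\in\{5,6,7\}$, the space $\mathrm{GST}_n=\mathrm{Ind}_n\cap\mathrm{Inf}_n\subset[0,1]^n$ is connected (in the subspace topology from $\mathbb{R}^n$).
   Context: Let $n\ge 3$. A symmetric $n$-player game with $n$ dichotomous causes $C_1,\dots,C_n$ (each of probability $1/2$) and $n$ dichotomous effects $E_1,\dots,E_n$ is encoded by a point $\mathbf{x}=(x_1,\dots,x_n)\in[0,1]^n$, where $x_s$ is the probability of the effect for a player when exactly $s$ players (including that player) have the same cause state as that player. Define $$\Psi(\mathbf{x})=\left(\frac{1}{2^{n-1}}\sum_{k=0}^{n-1}\binom{n-1}{k}x_{k+1}\right)^2-\frac{1}{2^{n-1}}\sum_{k=0}^{n-2}\binom{n-2}{k}\left(x_{k+2}^2+x_{k+1}x_{n-(k+1)}\right).$$ The independence space is $\mathrm{Ind}_n=\{\mathbf{x}\in[0,1]^n : \Psi(\mathbf{x})=0\}$ (this expresses $\mathbb{P}(E_i\wedge E_j\mid C_k)=\mathbb{P}(E_i\mid C_k)\mathbb{P}(E_j\mid C_k)$). The influence space is $\mathrm{Inf}_n=\{\mathbf{x}\in[0,1]^n : \text{there exists } s\in\{1,\dots,n\} \text{ with } x_s\ne x_{n-s+1}\}$ (this expresses that every cause influences every effect). Finally, $\mathrm{GST}_n=\mathrm{Ind}_n\cap\mathrm{Inf}_n$. *)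

theory Defs
  imports "HOL-Analysis.Analysis"
begin

(* A point (x_1, ..., x_n) of R^n is an extensional function on {1..n}, so that the
   coordinates keep the indices 1, ..., n; R^n itself is the product topology
   powertop_real {1..n}. *)

definition unit_cube :: "nat \<Rightarrow> (nat \<Rightarrow> real) set" where
  "unit_cube n = ({1..n} \<rightarrow>\<^sub>E {0..1})"

(* Only used for n >= 3. All subtractions on nat are then exact, and all coordinates
   that occur have indices in {1..n}. *)
definition Psi :: "nat \<Rightarrow> (nat \<Rightarrow> real) \<Rightarrow> real" where
  "Psi n x =
     (1 / 2 ^ (n - 1) * (\<Sum>k = 0..n - 1. real ((n - 1) choose k) * x (k + 1)))\<^sup>2
     - 1 / 2 ^ (n - 1) *
         (\<Sum>k = 0..n - 2. real ((n - 2) choose k) *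
            ((x (k + 2))\<^sup>2 + x (k + 1) * x (n - (k + 1))))"

definition Ind :: "nat \<Rightarrow> (nat \<Rightarrow> real) set" where
  "Ind n = {x \<in> unit_cube n. Psi n x = 0}"

definition Infl :: "nat \<Rightarrow> (nat \<Rightarrow> real) set" where
  "Infl n = {x \<in> unit_cube n. \<exists>s\<in>{1..n}. x s \<noteq> x (n - s + 1)}"

definition GST :: "nat \<Rightarrow> (nat \<Rightarrow> real) set" where
  "GST n = Ind n \<inter> Infl n"

end

theory Submission
  imports Defs "HOL-Library.Function_Algebras" "HOL-Library.Quadratic_Discriminant"
begin

text \<open>
  Let \<open>K\<close> be binomial with parameters \<open>n - 1\<close> and \<open>1 / 2\<close>. The polar form of the quadratic form
  \<open>Psi\<close> is the expectation of \<open>(M x - T x (K + 1)) * y (K + 1)\<close>, where \<open>M x\<close> is the expectation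
  of \<open>x (K + 1)\<close> and \<open>T x\<close> averages \<open>x\<close> over a second player. Its radical consists of the vectors
  that are constant on \<open>{1..n}\<close>, so around the centre of the cube the independence space is a cone,
  and it suffices that the non-palindromic null vectors form a connected set. On palindromic
  vectors \<open>Psi\<close> is a negative multiple of the variance of a sum of two neighbouring coordinates,
  so the palindromic null vectors are those of the form \<open>c + d * (- 1) ^ j\<close>: the radical for
  even \<open>n\<close>, and the radical plus a null line for odd \<open>n\<close>.

  For \<open>n \<ge> 5\<close> the form \<open>B\<close> is positive definite on some plane and negative definite on another.
  Let \<open>e\<close> be a null vector outside the radical. The null vectors \<open>x\<close> with \<open>B e x > 0\<close> form a
  retract of a half-space, and so do those with \<open>B e x < 0\<close>. A null vector \<open>x\<close> with \<open>B e x = 0\<close>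
  is a limit of both sides unless it lies in the span of \<open>e\<close> and the radical, and there are others
  because \<open>B\<close> is indefinite on the orthogonal complement of \<open>e\<close>. Hence the null cone without this
  span is connected.
\<close>

subsection \<open>Topological real vector spaces\<close>

class topological_real_vector = real_vector + topological_ab_group_add +
  assumes tendsto_scaleR_Pair:
    "((\<lambda>p. fst p *\<^sub>R snd p) \<longlongrightarrow> c *\<^sub>R a) (nhds (c :: real) \<times>\<^sub>F nhds a)"

lemma tendsto_scaleR_topological:
  fixes g :: "'a \<Rightarrow> 'b::topological_real_vector"
  assumes "(f \<longlongrightarrow> c) F" "(g \<longlongrightarrow> a) F"
  shows "((\<lambda>x. f x *\<^sub>R g x) \<longlongrightarrow> c *\<^sub>R a) F"
  using filterlim_compose[OF tendsto_scaleR_Pair, of "\<lambda>x. (f x, g x)" c a F] assms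
  by (simp add: nhds_prod[symmetric] tendsto_Pair)

lemma continuous_on_scaleR_topological [continuous_intros]:
  fixes g :: "'a::topological_space \<Rightarrow> 'b::topological_real_vector"
  assumes "continuous_on S f" "continuous_on S g"
  shows "continuous_on S (\<lambda>x. f x *\<^sub>R g x)"
  using assms unfolding continuous_on_def by (auto intro: tendsto_scaleR_topological)

lemma tendsto_coordinatewise:
  assumes "\<And>i. ((\<lambda>x. f x i) \<longlongrightarrow> l i) F"
  shows "(f \<longlongrightarrow> l) F"
proof -
  have "limitin (product_topology (\<lambda>_. euclidean) UNIV) f l F"
    using assms by (simp add: limitin_componentwise)
  then show ?thesis by (simp add: euclidean_product_topology)
qed

lemma tendsto_coordinate:
  fixes a :: "'i \<Rightarrow> 'b::topological_space"
  shows "((\<lambda>x. x i) \<longlongrightarrow> a i) (nhds a)"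
proof -
  have "continuous_on UNIV (\<lambda>x :: 'i \<Rightarrow> 'b. x i)" by simp
  then show ?thesis
    by (simp add: continuous_on_def flip: tendsto_at_iff_tendsto_nhds[of "\<lambda>x. x i" a])
qed

instantiation "fun" :: (type, real_vector) real_vector
begin

definition scaleR_fun :: "real \<Rightarrow> ('a \<Rightarrow> 'b) \<Rightarrow> 'a \<Rightarrow> 'b" where
  "c *\<^sub>R f = (\<lambda>x. c *\<^sub>R f x)"

instance
  by standard (simp_all add: scaleR_fun_def fun_eq_iff scaleR_add_left scaleR_add_right)

end

lemma scaleR_fun_apply [simp]: "(c *\<^sub>R f) x = c *\<^sub>R f x"
  by (simp add: scaleR_fun_def)

instance "fun" :: (type, topological_monoid_add) topological_monoid_add
proof
  fix a b :: "'a \<Rightarrow> 'b"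
  show "LIM x nhds a \<times>\<^sub>F nhds b. fst x + snd x :> nhds (a + b)"
    unfolding plus_fun_def
    by (rule tendsto_coordinatewise)
      (rule tendsto_add[OF filterlim_compose[OF tendsto_coordinate filterlim_fst]
          filterlim_compose[OF tendsto_coordinate filterlim_snd]])
qed

instance "fun" :: (type, topological_group_add) topological_group_add
proof
  fix a :: "'a \<Rightarrow> 'b"
  show "(uminus \<longlongrightarrow> - a) (nhds a)"
    by (intro tendsto_coordinatewise) (simp add: tendsto_minus tendsto_coordinate)
qed

instance "fun" :: (type, topological_ab_group_add) topological_ab_group_add ..

instance "fun" :: (type, topological_real_vector) topological_real_vector
proof
  fix c :: real and a :: "'a \<Rightarrow> 'b"
  show "((\<lambda>p. fst p *\<^sub>R snd p) \<longlongrightarrow> c *\<^sub>R a) (nhds c \<times>\<^sub>F nhds a)"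
    unfolding scaleR_fun_def
    by (rule tendsto_coordinatewise)
      (rule tendsto_scaleR_topological[OF filterlim_fst
          filterlim_compose[OF tendsto_coordinate filterlim_snd]])
qed

instance real_normed_vector \<subseteq> topological_real_vector
  by standard (rule tendsto_scaleR[OF filterlim_fst filterlim_snd])

lemma convex_imp_connected:
  fixes S :: "'a::topological_real_vector set"
  assumes "convex S"
  shows "connected S"
  unfolding connected_iff_connected_component
proof (intro ballI)
  fix x y assume "x \<in> S" "y \<in> S"
  then have "closed_segment x y \<subseteq> S"
    using assms by (simp add: closed_segment_subset)
  moreover have "connected (closed_segment x y)"
    unfolding closed_segment_image_interval
    by (intro connected_continuous_image continuous_intros) auto
  ultimately show "connected_component S x y"
    unfolding connected_component_def by blast
qed

lemma in_closure_if_open_ray_subset: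
  fixes x v :: "'a::topological_real_vector"
  assumes "\<And>t. t > 0 \<Longrightarrow> x + t *\<^sub>R v \<in> S"
  shows "x \<in> closure S"
proof -
  have "(\<lambda>t. x + t *\<^sub>R v) ` closure {0<..} \<subseteq> closure S"
    using assms closure_subset
    by (intro image_closure_subset continuous_intros) auto
  then show ?thesis by (force simp: closure_greaterThan)
qed

subsection \<open>Null cones of symmetric bilinear forms\<close>

definition null_cone :: "('a \<Rightarrow> 'a \<Rightarrow> real) \<Rightarrow> 'a set" where
  "null_cone B = {x. B x x = 0}"

definition form_radical :: "('a \<Rightarrow> 'a \<Rightarrow> real) \<Rightarrow> 'a set" where
  "form_radical B = {x. \<forall>y. B x y = 0}"

locale continuous_symmetric_form =
  fixes B :: "'a::topological_real_vector \<Rightarrow> 'a \<Rightarrow> real"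
  assumes bilinear: "bilinear B"
    and symmetric: "B x y = B y x"
    and continuous: "continuous_on UNIV (\<lambda>(x, y). B x y)"
begin

lemmas form_simps =
  bilinear_ladd[OF bilinear] bilinear_radd[OF bilinear] bilinear_lsub[OF bilinear]
  bilinear_rsub[OF bilinear] bilinear_lmul[OF bilinear] bilinear_rmul[OF bilinear]
  bilinear_lneg[OF bilinear] bilinear_rneg[OF bilinear]

lemma linear_form: "linear (B x)"
  using bilinear by (simp add: bilinear_def)

lemma continuous_on_form:
  assumes "continuous_on S f" "continuous_on S g"
  shows "continuous_on S (\<lambda>x. B (f x) (g x))"
  using continuous_on_compose2[OF continuous continuous_on_Pair[OF assms]] by simp

lemma subspace_radical: "subspace (form_radical B)"
  unfolding subspace_def form_radical_def
  by (simp add: form_simps bilinear_lzero[OF bilinear])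

lemma span_radical: "span (form_radical B) = form_radical B"
  by (simp add: subspace_radical)

lemma form_add_radical:
  assumes "r \<in> form_radical B"
  shows "B (x + r) (x + r) = B x x"
  using assms symmetric[of x r] by (simp add: form_radical_def form_simps)

lemma orthogonal_if_in_span:
  assumes "B e e = 0" "x \<in> span (insert e (form_radical B))"
  shows "B e x = 0"
proof -
  obtain c where "x - c *\<^sub>R e \<in> form_radical B"
    using assms(2) unfolding span_breakdown_eq span_radical by blast
  then have "B (x - c *\<^sub>R e) e = 0" by (simp add: form_radical_def)
  then show ?thesis using assms(1) symmetric[of x e] by (simp add: form_simps)
qed

definition null_side :: "'a \<Rightarrow> 'a set" where
  "null_side e = {x \<in> null_cone B. B e x > 0}"

text \<open>Since \<open>e\<close> is null, the form is affine along lines parallel to \<open>e\<close>, so sliding along \<open>e\<close>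
  retracts the half-space onto the null vectors it contains.\<close>

lemma connected_null_side:
  assumes "B e e = 0"
  shows "connected (null_side e)"
proof (rule retract_of_connected)
  define slide where "slide = (\<lambda>x. x - (B x x / (2 * B e x)) *\<^sub>R e)"
  have "convex (B e -` {0<..})"
    by (intro convex_linear_vimage linear_form convex_real_interval)
  then show "connected {x. B e x > 0}"
    by (intro convex_imp_connected) (simp add: vimage_def)
  have "retraction {x. B e x > 0} (null_side e) slide"
    unfolding retraction_def
  proof (intro conjI funcsetI ballI)
    show "continuous_on {x. B e x > 0} slide"
      unfolding slide_def diff_conv_add_uminus
      by (intro continuous_intros continuous_on_form) auto
    fix x assume "x \<in> {x. B e x > 0}"
    then show "slide x \<in> null_side e"
      using assms symmetric[of x e]
      by (simp add: slide_def null_side_def null_cone_def form_simps)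
  qed (auto simp: slide_def null_side_def null_cone_def)
  then show "null_side e retract_of {x. B e x > 0}"
    by (auto simp: retract_of_def)
qed

lemma orthogonal_in_closure_null_side:
  assumes "B e e = 0" "x \<in> null_cone B" "B e x = 0" "B x w = 0" "B e w \<noteq> 0"
  shows "x \<in> closure (null_side e)"
proof (rule in_closure_if_open_ray_subset)
  define v where "v = w - (B w w / (2 * B e w)) *\<^sub>R e"
  have v_products: "B v v = 0" "B x v = 0" "B e v = B e w"
    using assms symmetric[of w e] symmetric[of x e] by (simp_all add: v_def form_simps)
  fix t :: real assume "t > 0"
  then have "t * (B e w * B e w) > 0"
    using assms(5) by (intro mult_pos_pos[of t]) (auto simp flip: power2_eq_square)
  then show "x + t *\<^sub>R (B e w *\<^sub>R v) \<in> null_side e"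
    using assms v_products symmetric[of v x]
    by (simp add: null_side_def null_cone_def form_simps)
qed

lemma exists_orthogonal_not_orthogonal:
  assumes "e \<notin> form_radical B" "x \<notin> span (insert e (form_radical B))"
  shows "\<exists>w. B x w = 0 \<and> B e w \<noteq> 0"
proof (rule ccontr)
  assume "\<not> ?thesis"
  then have kernel_subset: "B e w = 0" if "B x w = 0" for w using that by blast
  have "x \<notin> form_radical B" using assms(2) by (auto intro: span_base)
  then obtain z where "B x z \<noteq> 0" by (auto simp: form_radical_def)
  then have "B (e - (B e z / B x z) *\<^sub>R x) w = 0" for w
    using kernel_subset[of "w - (B x w / B x z) *\<^sub>R z"] by (simp add: form_simps)
  then have "e - (B e z / B x z) *\<^sub>R x \<in> form_radical B"
    by (simp add: form_radical_def)
  then have "e \<in> span (insert x (form_radical B))"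
    unfolding span_breakdown_eq span_radical by blast
  then show False using in_span_insert[of e x "form_radical B"] assms by (simp add: span_radical)
qed

lemma connected_null_cone_minus_span_if_orthogonal:
  assumes null: "B e e = 0" and not_radical: "e \<notin> form_radical B"
    and orthogonal: "u \<in> null_cone B" "B e u = 0" "u \<notin> span (insert e (form_radical B))"
  shows "connected (null_cone B - span (insert e (form_radical B)))"
proof -
  let ?C = "null_cone B - span (insert e (form_radical B))"
  define wall where "wall = {x \<in> ?C. B e x = 0}"
  have wall_subset: "wall \<subseteq> closure (null_side e)" "wall \<subseteq> closure (null_side (- e))"
  proof safe
    fix x assume "x \<in> wall"
    then have x_wall: "x \<in> null_cone B" "B e x = 0" "x \<notin> span (insert e (form_radical B))"
      by (auto simp: wall_def)
    then obtain w where "B x w = 0" "B e w \<noteq> 0"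
      using exists_orthogonal_not_orthogonal[OF not_radical] by blast
    then show "x \<in> closure (null_side e)" "x \<in> closure (null_side (- e))"
      using null x_wall by (auto intro!: orthogonal_in_closure_null_side[of _ x w] simp: form_simps)
  qed
  have connected_side_Un_wall: "connected (null_side e' \<union> wall)"
    if "B e' e' = 0" "wall \<subseteq> closure (null_side e')" for e'
    using connected_intermediate_closure[OF connected_null_side[OF that(1)]] that(2)
    by (simp add: closure_subset)
  have "connected (null_side e \<union> wall)" "connected (null_side (- e) \<union> wall)"
    using null wall_subset by (auto intro!: connected_side_Un_wall simp: form_simps)
  moreover have "u \<in> wall" using orthogonal by (simp add: wall_def)
  ultimately have "connected ((null_side e \<union> wall) \<union> (null_side (- e) \<union> wall))"
    by (intro connected_Un[of "null_side e \<union> wall"]) auto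
  moreover have "?C = (null_side e \<union> wall) \<union> (null_side (- e) \<union> wall)"
    using orthogonal_if_in_span[OF null] by (force simp: wall_def null_side_def form_simps)
  ultimately show ?thesis by (simp only:)
qed

lemma span_insert_Int_span_insert_radical:
  assumes "u \<notin> span (insert e (form_radical B))"
  shows "span (insert e (form_radical B)) \<inter> span (insert u (form_radical B)) = form_radical B"
proof (intro equalityI subsetI)
  fix x assume x_in: "x \<in> span (insert e (form_radical B)) \<inter> span (insert u (form_radical B))"
  show "x \<in> form_radical B"
  proof (rule ccontr)
    assume "x \<notin> form_radical B"
    then have "u \<in> span (insert x (form_radical B))"
      using x_in in_span_insert[of x u "form_radical B"] by (simp add: span_radical)
    moreover have "span (insert x (form_radical B)) \<subseteq> span (insert e (form_radical B))"
      using x_in by (intro span_minimal) (auto intro: span_base)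
    ultimately show False using assms by blast
  qed
qed (auto intro: span_base)

lemma connected_null_cone_minus_radical_if_orthogonal:
  assumes null: "B e e = 0" and not_radical: "e \<notin> form_radical B"
    and orthogonal: "u \<in> null_cone B" "B e u = 0" "u \<notin> span (insert e (form_radical B))"
  shows "connected (null_cone B - form_radical B)"
proof -
  let ?C = "\<lambda>e. null_cone B - span (insert e (form_radical B))"
  have null_u: "B u u = 0" using orthogonal by (simp add: null_cone_def)
  have "u \<notin> form_radical B" using orthogonal(3) by (auto intro: span_base)
  have e_notin: "e \<notin> span (insert u (form_radical B))"
    using in_span_insert[of e u "form_radical B"] not_radical orthogonal(3)
    by (auto simp: span_radical)
  have "connected (?C e)"
    using null not_radical orthogonal by (rule connected_null_cone_minus_span_if_orthogonal)
  moreover have "connected (?C u)"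
    using null null_u orthogonal(2) e_notin \<open>u \<notin> form_radical B\<close> symmetric[of u e]
    by (intro connected_null_cone_minus_span_if_orthogonal[of u e]) (auto simp: null_cone_def)
  moreover have "e + u \<in> ?C e \<inter> ?C u"
    using null null_u orthogonal(2,3) e_notin symmetric[of u e]
    by (auto simp: null_cone_def form_simps span_add_eq span_add_eq2 span_base)
  ultimately have "connected (?C e \<union> ?C u)" by (intro connected_Un) auto
  moreover have "?C e \<union> ?C u = null_cone B - form_radical B"
    using span_insert_Int_span_insert_radical[OF orthogonal(3)] by blast
  ultimately show ?thesis by (simp only:)
qed

end

lemma exists_nonzero_in_plane_kernel:
  fixes f :: "'a::real_vector \<Rightarrow> real"
  assumes "linear f"
  obtains a b where "(a, b) \<noteq> (0, 0)" "f (a *\<^sub>R v + b *\<^sub>R w) = 0"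
proof (cases "f v = 0")
  case True
  then show ?thesis using that[of 1 0] by simp
next
  case False
  then show ?thesis
    using that[of "f w" "- f v"] by (simp add: linear_diff[OF assms] linear_scale[OF assms])
qed

locale doubly_indefinite_form = continuous_symmetric_form B
  for B :: "'a::topological_real_vector \<Rightarrow> 'a \<Rightarrow> real" +
  fixes p p' m m' :: 'a
  assumes positive_plane:
      "(a, b) \<noteq> (0, 0) \<Longrightarrow> B (a *\<^sub>R p + b *\<^sub>R p') (a *\<^sub>R p + b *\<^sub>R p') > 0"
    and negative_plane:
      "(a, b) \<noteq> (0, 0) \<Longrightarrow> B (a *\<^sub>R m + b *\<^sub>R m') (a *\<^sub>R m + b *\<^sub>R m') < 0"
begin

lemma exists_orthogonal_null_vector:
  assumes "B e e = 0"
  obtains u where "u \<in> null_cone B" "B e u = 0" "u \<notin> span (insert e (form_radical B))"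
proof -
  obtain a b where "(a, b) \<noteq> (0, 0)" "B e (a *\<^sub>R p + b *\<^sub>R p') = 0"
    by (rule exists_nonzero_in_plane_kernel[OF linear_form])
  with positive_plane obtain v where v_pos: "B e v = 0" "B v v > 0" by blast
  obtain a b where "(a, b) \<noteq> (0, 0)" "B e (a *\<^sub>R m + b *\<^sub>R m') = 0"
    by (rule exists_nonzero_in_plane_kernel[OF linear_form])
  with negative_plane obtain w where w_neg: "B e w = 0" "B w w < 0" by blast
  have "discrim (B w w) (2 * B v w) (B v v) \<ge> 0"
    using less_le_trans[OF mult_neg_pos[OF w_neg(2) v_pos(2)] zero_le_power2[of "B v w"]]
    by (simp add: discrim_def power_mult_distrib)
  then obtain t where "B w w * t\<^sup>2 + 2 * B v w * t + B v v = 0"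
    using discriminant_nonneg_ex w_neg(2) by (metis less_irrefl)
  then have "v + t *\<^sub>R w \<in> null_cone B"
    using symmetric[of w v] by (simp add: null_cone_def form_simps power2_eq_square algebra_simps)
  moreover have "B e (v + t *\<^sub>R w) = 0" using v_pos w_neg by (simp add: form_simps)
  moreover have "v + t *\<^sub>R w \<notin> span (insert e (form_radical B))"
  proof
    assume "v + t *\<^sub>R w \<in> span (insert e (form_radical B))"
    then obtain c where "v + t *\<^sub>R w - c *\<^sub>R e \<in> form_radical B"
      unfolding span_breakdown_eq span_radical by blast
    from form_add_radical[OF this, of "c *\<^sub>R e - t *\<^sub>R w"]
    have "B v v = B (c *\<^sub>R e - t *\<^sub>R w) (c *\<^sub>R e - t *\<^sub>R w)" by simp
    also have "\<dots> = t\<^sup>2 * B w w"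
      using assms w_neg symmetric[of w e] by (simp add: form_simps power2_eq_square)
    finally show False using v_pos w_neg by (simp add: mult_nonneg_nonpos not_le[symmetric])
  qed
  ultimately show thesis using that by blast
qed

theorem connected_null_cone_minus_span:
  assumes "B e e = 0" "e \<notin> form_radical B"
  shows "connected (null_cone B - span (insert e (form_radical B)))"
  using exists_orthogonal_null_vector[OF assms(1)]
    connected_null_cone_minus_span_if_orthogonal[OF assms] by blast

theorem connected_null_cone_minus_radical: "connected (null_cone B - form_radical B)"
proof -
  obtain e where "e \<in> null_cone B" "e \<notin> span (insert 0 (form_radical B))"
    using exists_orthogonal_null_vector[of 0] by (auto simp: bilinear_lzero[OF bilinear])
  then have "B e e = 0" "e \<notin> form_radical B"
    by (simp_all add: null_cone_def span_radical)
  then show ?thesis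
    using exists_orthogonal_null_vector[of e] connected_null_cone_minus_radical_if_orthogonal
    by blast
qed

end

subsection \<open>Binomial means\<close>

definition binomial_mean :: "nat \<Rightarrow> (nat \<Rightarrow> real) \<Rightarrow> real" where
  "binomial_mean n f = (\<Sum>j = 1..n. real ((n - 1) choose (j - 1)) * f j) / 2 ^ (n - 1)"

lemma binomial_mean_Suc:
  "binomial_mean (Suc m) f = (\<Sum>k = 0..m. real (m choose k) * f (Suc k)) / 2 ^ m"
  unfolding binomial_mean_def
  by (simp add: sum.shift_bounds_cl_Suc_ivl del: sum.cl_ivl_Suc)

lemma binomial_mean_cong:
  assumes "\<And>j. j \<in> {1..n} \<Longrightarrow> f j = g j"
  shows "binomial_mean n f = binomial_mean n g"
  using assms by (simp add: binomial_mean_def)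

lemma linear_binomial_mean: "linear (binomial_mean n)"
  by (rule linearI)
    (simp_all add: binomial_mean_def sum.distrib sum_distrib_left add_divide_distrib algebra_simps)

lemma binomial_mean_const:
  assumes "n \<ge> 1"
  shows "binomial_mean n (\<lambda>_. c) = c"
proof -
  obtain m where "n = Suc m" using assms by (cases n) auto
  moreover have "(\<Sum>k = 0..m. real (m choose k)) = 2 ^ m"
    using choose_row_sum[of m] by (simp add: atLeast0AtMost flip: of_nat_sum)
  ultimately show ?thesis by (simp add: binomial_mean_Suc flip: sum_distrib_right)
qed

lemma binomial_mean_reflect: "binomial_mean n (\<lambda>j. f (n + 1 - j)) = binomial_mean n f"
proof (cases n)
  case (Suc m)
  have "(\<Sum>k = 0..m. real (m choose k) * f (Suc m - k)) =
      (\<Sum>k = 0..m. real (m choose k) * f (Suc k))"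
    by (rule sum.reindex_bij_witness[of _ "\<lambda>k. m - k" "\<lambda>k. m - k"])
      (auto simp: binomial_symmetric[symmetric] Suc_diff_le)
  then show ?thesis using Suc by (simp add: binomial_mean_Suc)
qed (simp add: binomial_mean_def)

lemma binomial_mean_Pascal:
  assumes "n \<ge> 1"
  shows "binomial_mean (Suc n) f = binomial_mean n (\<lambda>j. f j + f (Suc j)) / 2"
proof -
  obtain m where n_eq: "n = Suc m" using assms by (cases n) auto
  have "(\<Sum>k = 0..Suc m. real (Suc m choose k) * f (Suc k)) =
      f 1 + (\<Sum>k = 0..m. real (m choose Suc k) * f (Suc (Suc k)))
        + (\<Sum>k = 0..m. real (m choose k) * f (Suc (Suc k)))"
    by (subst sum.atLeast0_atMost_Suc_shift) (simp add: sum.distrib algebra_simps)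
  also have "f 1 + (\<Sum>k = 0..m. real (m choose Suc k) * f (Suc (Suc k))) =
      (\<Sum>k = 0..Suc m. real (m choose k) * f (Suc k))"
    by (subst sum.atLeast0_atMost_Suc_shift) simp
  finally show ?thesis
    by (simp add: n_eq binomial_mean_Suc sum.distrib algebra_simps)
qed

lemma binomial_mean_eq_0_iff:
  assumes "\<And>j. j \<in> {1..n} \<Longrightarrow> f j \<ge> 0"
  shows "binomial_mean n f = 0 \<longleftrightarrow> (\<forall>j\<in>{1..n}. f j = 0)"
proof -
  have "binomial_mean n f = 0 \<longleftrightarrow> (\<forall>j\<in>{1..n}. real ((n - 1) choose (j - 1)) * f j = 0)"
    unfolding binomial_mean_def using assms
    by (subst divide_eq_0_iff, subst sum_nonneg_eq_0_iff) auto
  also have "\<dots> \<longleftrightarrow> (\<forall>j\<in>{1..n}. f j = 0)" by (intro ball_cong) (auto simp: binomial_eq_0_iff)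
  finally show ?thesis .
qed

lemma binomial_mean_power2_eq_iff:
  assumes "n \<ge> 1"
  shows "binomial_mean n (\<lambda>j. (f j)\<^sup>2) = (binomial_mean n f)\<^sup>2 \<longleftrightarrow> (\<exists>c. \<forall>j\<in>{1..n}. f j = c)"
proof
  define \<mu> where "\<mu> = binomial_mean n f"
  assume "binomial_mean n (\<lambda>j. (f j)\<^sup>2) = (binomial_mean n f)\<^sup>2"
  moreover have "(\<lambda>j. (f j - \<mu>)\<^sup>2) = (\<lambda>j. (f j)\<^sup>2) - (2 * \<mu>) *\<^sub>R f + (\<lambda>_. \<mu>\<^sup>2)"
    by (simp add: fun_eq_iff power2_eq_square algebra_simps)
  ultimately have "binomial_mean n (\<lambda>j. (f j - \<mu>)\<^sup>2) = 0"
    using assms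
    by (simp add: linear_add[OF linear_binomial_mean] linear_diff[OF linear_binomial_mean]
        linear_scale[OF linear_binomial_mean] binomial_mean_const \<mu>_def power2_eq_square)
  then show "\<exists>c. \<forall>j\<in>{1..n}. f j = c" by (simp add: binomial_mean_eq_0_iff)
next
  assume "\<exists>c. \<forall>j\<in>{1..n}. f j = c"
  then obtain c where f_eq: "f j = c" if "j \<in> {1..n}" for j by blast
  have "binomial_mean n f = c"
    using binomial_mean_cong[OF f_eq] binomial_mean_const[OF assms] by simp
  moreover have "binomial_mean n (\<lambda>j. (f j)\<^sup>2) = c\<^sup>2"
    using binomial_mean_cong[of n "\<lambda>j. (f j)\<^sup>2" "\<lambda>_. c\<^sup>2"] f_eq binomial_mean_const[OF assms]
    by simp
  ultimately show "binomial_mean n (\<lambda>j. (f j)\<^sup>2) = (binomial_mean n f)\<^sup>2" by simp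
qed

lemma binomial_mean_supported:
  assumes "distinct js" "set js \<subseteq> {1..n}" "\<And>j. j \<notin> set js \<Longrightarrow> f j = 0"
  shows "binomial_mean n f = (\<Sum>j\<leftarrow>js. real ((n - 1) choose (j - 1)) * f j) / 2 ^ (n - 1)"
  unfolding binomial_mean_def sum.distinct_set_conv_list[OF assms(1), symmetric]
  using assms(2,3) by (subst sum.mono_neutral_right[of _ "set js"]) auto

subsection \<open>The polar form\<close>

text \<open>The probability of the effect for a random other player, if \<open>j\<close> players share the state of a
  given one: \<open>j - 1\<close> others belong to this group, and \<open>n - j\<close> to the complementary one. For
  \<open>j = n\<close> the junk coordinate \<open>x 0\<close> has weight \<open>0\<close>.\<close>

definition peer_mean :: "nat \<Rightarrow> (nat \<Rightarrow> real) \<Rightarrow> nat \<Rightarrow> real" where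
  "peer_mean n x j = (real (j - 1) * x j + real (n - j) * x (n - j)) / real (n - 1)"

definition Psi_polar :: "nat \<Rightarrow> (nat \<Rightarrow> real) \<Rightarrow> (nat \<Rightarrow> real) \<Rightarrow> real" where
  "Psi_polar n x y = binomial_mean n (\<lambda>j. (binomial_mean n x - peer_mean n x j) * y j)"

lemma Psi_polar_eq:
  "Psi_polar n x y =
     binomial_mean n x * binomial_mean n y - binomial_mean n (\<lambda>j. peer_mean n x j * y j)"
proof -
  have "(\<lambda>j. (binomial_mean n x - peer_mean n x j) * y j) =
      binomial_mean n x *\<^sub>R y - (\<lambda>j. peer_mean n x j * y j)"
    by (simp add: fun_eq_iff algebra_simps)
  then show ?thesis
    by (simp add: Psi_polar_def linear_diff[OF linear_binomial_mean]
        linear_scale[OF linear_binomial_mean])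
qed

lemma binomial_mean_peer_mean:
  assumes "n \<ge> 1"
  shows "binomial_mean (Suc n) (\<lambda>j. peer_mean (Suc n) x j * y j) =
    binomial_mean n (\<lambda>j. x (Suc j) * y (Suc j) + x (n + 1 - j) * y j) / 2"
proof -
  obtain m where n_eq: "n = Suc m" using assms by (cases n) auto
  have absorption: "real (Suc k * (n choose Suc k)) / real n = real (m choose k)"
      "real ((n - k) * (n choose k)) / real n = real (m choose k)" for k
    unfolding n_eq Suc_times_binomial binomial_absorb_comp by (simp_all del: of_nat_Suc mult_Suc)
  have "(\<Sum>k = 0..n. real (n choose k) * (peer_mean (Suc n) x (Suc k) * y (Suc k))) =
      (\<Sum>k = 0..n. real (k * (n choose k)) / real n * (x (Suc k) * y (Suc k)))
      + (\<Sum>k = 0..n. real ((n - k) * (n choose k)) / real n * (x (n - k) * y (Suc k)))"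
    unfolding sum.distrib[symmetric]
    by (intro sum.cong)
      (simp_all add: peer_mean_def add_divide_distrib distrib_left distrib_right ac_simps)
  also have "(\<Sum>k = 0..n. real (k * (n choose k)) / real n * (x (Suc k) * y (Suc k))) =
      (\<Sum>k = 0..m. real (m choose k) * (x (Suc (Suc k)) * y (Suc (Suc k))))"
    unfolding absorption(1)[symmetric] by (simp only: n_eq sum.atLeast0_atMost_Suc_shift)
      (simp del: of_nat_Suc mult_Suc binomial_Suc_Suc)
  also have "(\<Sum>k = 0..n. real ((n - k) * (n choose k)) / real n * (x (n - k) * y (Suc k))) =
      (\<Sum>k = 0..m. real (m choose k) * (x (n - k) * y (Suc k)))"
    unfolding absorption(2) by (simp add: n_eq)
  finally show ?thesis
    by (simp add: n_eq binomial_mean_Suc sum.distrib algebra_simps)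
qed

lemma Psi_eq_Psi_polar:
  assumes "n \<ge> 2"
  shows "Psi n x = Psi_polar n x x"
proof -
  obtain m where "n = Suc (Suc m)"
    using assms by (metis Suc_le_D Suc_le_mono numeral_2_eq_2)
  then show ?thesis
    by (simp add: Psi_def Psi_polar_eq binomial_mean_peer_mean)
      (simp add: binomial_mean_Suc power2_eq_square algebra_simps)
qed

lemma Psi_polar_symmetric:
  assumes "n \<ge> 2"
  shows "Psi_polar n x y = Psi_polar n y x"
proof -
  obtain m where n_eq: "n = Suc m" "m \<ge> 1" using assms by (cases n) auto
  have swap: "binomial_mean m (\<lambda>j. x (m + 1 - j) * y j) =
      binomial_mean m (\<lambda>j. y (m + 1 - j) * x j)"
    by (subst binomial_mean_reflect[symmetric]) (intro binomial_mean_cong, simp)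
  have "binomial_mean m (\<lambda>j. x (Suc j) * y (Suc j) + x (m + 1 - j) * y j) =
      binomial_mean m (\<lambda>j. y (Suc j) * x (Suc j) + y (m + 1 - j) * x j)"
    using swap linear_add[OF linear_binomial_mean]
    by (simp add: plus_fun_def mult.commute)
  then show ?thesis
    using n_eq by (simp add: Psi_polar_eq binomial_mean_peer_mean)
qed

lemma bilinear_Psi_polar:
  assumes "n \<ge> 2"
  shows "bilinear (Psi_polar n)"
proof -
  have "linear (\<lambda>y. Psi_polar n x y)" for x
    unfolding Psi_polar_def
    by (intro linear_compose[OF _ linear_binomial_mean, unfolded o_def] linearI)
      (simp_all add: fun_eq_iff algebra_simps)
  then show ?thesis
    unfolding bilinear_def using Psi_polar_symmetric[OF assms] by simp
qed

lemma continuous_symmetric_form_Psi_polar: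
  assumes "n \<ge> 2"
  shows "continuous_symmetric_form (Psi_polar n)"
proof
  show "continuous_on UNIV (\<lambda>(x, y). Psi_polar n x y)"
    unfolding case_prod_beta Psi_polar_def binomial_mean_def peer_mean_def divide_inverse
    by (intro continuous_intros continuous_on_product_then_coordinatewise continuous_on_fst
        continuous_on_snd)
qed (use bilinear_Psi_polar Psi_polar_symmetric assms in auto)

lemma peer_mean_constant_iff:
  assumes "n \<ge> 2"
  shows "(\<forall>j\<in>{1..n}. peer_mean n x j = c) \<longleftrightarrow> (\<forall>j\<in>{1..n}. x j = c)"
proof (intro iffI ballI)
  fix j assume "\<forall>j\<in>{1..n}. peer_mean n x j = c" and j_range: "j \<in> {1..n}"
  then have peer: "(real j - 1) * (x j - c) = - (real n - real j) * (x (n - j) - c)"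
    if "j \<in> {1..n}" for j
    using that assms by (fastforce simp: peer_mean_def field_simps of_nat_diff)
  show "x j = c"
  proof (cases "j = n")
    case True
    then show ?thesis using peer[of n] assms by simp
  next
    case False
    then have "(real n - real j - 1) * (x (n - j) - c) = - real j * (x j - c)"
      using peer[of "n - j"] j_range by (auto simp: of_nat_diff)
    then have "(real j - 1) * (real n - real j - 1) * (x j - c) =
        (real n - real j) * real j * (x j - c)"
      using peer[OF j_range] by algebra
    then have "(real n - 1) * (x j - c) = 0" by algebra
    then show ?thesis using assms by simp
  qed
next
  fix j assume "\<forall>j\<in>{1..n}. x j = c" "j \<in> {1..n}"
  then show "peer_mean n x j = c"
    using assms by (cases "j = n") (auto simp: peer_mean_def field_simps of_nat_diff)
qed

lemma form_radical_Psi_polar: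
  assumes "n \<ge> 2"
  shows "form_radical (Psi_polar n) = {x. \<exists>c. \<forall>j\<in>{1..n}. x j = c}"
proof (intro equalityI subsetI)
  fix x :: "nat \<Rightarrow> real" assume "x \<in> {x. \<exists>c. \<forall>j\<in>{1..n}. x j = c}"
  then obtain c where x_eq: "\<forall>j\<in>{1..n}. x j = c" by blast
  have "binomial_mean n x = c"
    using binomial_mean_cong[of n x "\<lambda>_. c"] binomial_mean_const[of n c] x_eq assms by simp
  moreover have "\<forall>j\<in>{1..n}. peer_mean n x j = c"
    using x_eq peer_mean_constant_iff[OF assms] by blast
  ultimately have "Psi_polar n x y = binomial_mean n (\<lambda>_. 0)" for y
    unfolding Psi_polar_def by (intro binomial_mean_cong) simp
  then show "x \<in> form_radical (Psi_polar n)"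
    using assms by (simp add: form_radical_def binomial_mean_const)
next
  fix x assume x_radical: "x \<in> form_radical (Psi_polar n)"
  define c where "c = binomial_mean n x"
  have "binomial_mean n (\<lambda>j. (c - peer_mean n x j)\<^sup>2) = Psi_polar n x (\<lambda>j. c - peer_mean n x j)"
    by (simp add: Psi_polar_def c_def power2_eq_square)
  also have "\<dots> = 0" using x_radical by (simp add: form_radical_def)
  finally have "\<forall>j\<in>{1..n}. peer_mean n x j = c" by (simp add: binomial_mean_eq_0_iff)
  then show "x \<in> {x. \<exists>c. \<forall>j\<in>{1..n}. x j = c}"
    unfolding peer_mean_constant_iff[OF assms] by blast
qed

definition palindromic :: "nat \<Rightarrow> (nat \<Rightarrow> real) set" where
  "palindromic n = {x. \<forall>s\<in>{1..n}. x s = x (n - s + 1)}"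

lemma palindromicD: "x \<in> palindromic n \<Longrightarrow> s \<in> {1..n} \<Longrightarrow> x s = x (n - s + 1)"
  by (simp add: palindromic_def)

lemma binomial_mean_palindromic_shift:
  assumes "x \<in> palindromic (Suc n)"
  shows "binomial_mean n (\<lambda>j. x (Suc j) * (x j + x (Suc j))) =
    binomial_mean n (\<lambda>j. x j * (x j + x (Suc j)))"
proof -
  have "x (Suc (n + 1 - j)) = x j" "x (n + 1 - j) = x (Suc j)" if "j \<in> {1..n}" for j
    using palindromicD[OF assms, of j] palindromicD[OF assms, of "Suc j"] that
    by (simp_all add: Suc_diff_le)
  then have "binomial_mean n (\<lambda>j. x j * (x j + x (Suc j))) =
      binomial_mean n (\<lambda>j. x (Suc (n + 1 - j)) * (x (n + 1 - j) + x (Suc (n + 1 - j))))"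
    by (intro binomial_mean_cong) simp
  also have "\<dots> = binomial_mean n (\<lambda>j. x (Suc j) * (x j + x (Suc j)))"
    by (rule binomial_mean_reflect)
  finally show ?thesis by (rule sym)
qed

lemma Psi_polar_palindromic:
  assumes "n \<ge> 1" "x \<in> palindromic (Suc n)"
  defines "s \<equiv> \<lambda>j. x j + x (Suc j)"
  shows "4 * Psi_polar (Suc n) x x = (binomial_mean n s)\<^sup>2 - binomial_mean n (\<lambda>j. (s j)\<^sup>2)"
proof -
  have "binomial_mean n (\<lambda>j. x (Suc j) * x (Suc j) + x (n + 1 - j) * x j) =
      binomial_mean n (\<lambda>j. x (Suc j) * s j)"
  proof (rule binomial_mean_cong)
    fix j assume "j \<in> {1..n}"
    then show "x (Suc j) * x (Suc j) + x (n + 1 - j) * x j = x (Suc j) * s j"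
      using palindromicD[OF assms(2), of "Suc j"] by (simp add: s_def Suc_diff_le distrib_left)
  qed
  moreover have "binomial_mean n (\<lambda>j. x (Suc j) * s j) = binomial_mean n (\<lambda>j. x j * s j)"
    unfolding s_def by (rule binomial_mean_palindromic_shift[OF assms(2)])
  moreover have "(\<lambda>j. (s j)\<^sup>2) = (\<lambda>j. x (Suc j) * s j) + (\<lambda>j. x j * s j)"
    by (simp add: fun_eq_iff s_def power2_eq_square algebra_simps)
  then have "binomial_mean n (\<lambda>j. (s j)\<^sup>2) =
      binomial_mean n (\<lambda>j. x (Suc j) * s j) + binomial_mean n (\<lambda>j. x j * s j)"
    by (simp only: linear_add[OF linear_binomial_mean])
  moreover have "binomial_mean n s = 2 * binomial_mean (Suc n) x"
    using binomial_mean_Pascal[OF assms(1), of x] by (simp add: s_def)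
  ultimately show ?thesis
    using assms(1) by (simp add: Psi_polar_eq binomial_mean_peer_mean power2_eq_square)
qed

definition affine_alternating :: "nat \<Rightarrow> (nat \<Rightarrow> real) set" where
  "affine_alternating n = {x. \<exists>c d. \<forall>j\<in>{1..n}. x j = c + d * (- 1) ^ j}"

lemma neighbour_sums_constant_iff:
  "(\<exists>c. \<forall>j\<in>{1..n}. x j + x (Suc j) = c) \<longleftrightarrow> x \<in> affine_alternating (Suc n)"
proof
  assume "\<exists>c. \<forall>j\<in>{1..n}. x j + x (Suc j) = c"
  then obtain c where neighbour: "x j + x (Suc j) = c" if "j \<in> {1..n}" for j by blast
  define d where "d = c / 2 - x 1"
  have "x j = c / 2 + d * (- 1) ^ j" if "1 \<le> j" "j \<le> Suc n" for j
    using that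
  proof (induction j rule: dec_induct)
    case base
    then show ?case by (simp add: d_def)
  next
    case (step j)
    then show ?case using neighbour[of j] by simp
  qed
  then show "x \<in> affine_alternating (Suc n)"
    unfolding affine_alternating_def by (intro CollectI exI[of _ "c / 2"] exI[of _ d]) auto
next
  assume "x \<in> affine_alternating (Suc n)"
  then obtain c d where "x j = c + d * (- 1) ^ j" if "j \<in> {1..Suc n}" for j
    unfolding affine_alternating_def by blast
  then show "\<exists>c. \<forall>j\<in>{1..n}. x j + x (Suc j) = c"
    by (intro exI[of _ "2 * c"]) simp
qed

lemma null_cone_Int_palindromic:
  assumes "n \<ge> 2"
  shows "null_cone (Psi_polar n) \<inter> palindromic n = palindromic n \<inter> affine_alternating n"
proof -
  obtain m where n_eq: "n = Suc m" "m \<ge> 1" using assms by (cases n) auto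
  have "Psi_polar n x x = 0 \<longleftrightarrow> x \<in> affine_alternating n" if "x \<in> palindromic n" for x
    using Psi_polar_palindromic[of m x] that
      binomial_mean_power2_eq_iff[of m "\<lambda>j. x j + x (Suc j)"]
    unfolding n_eq(1) neighbour_sums_constant_iff[symmetric] using n_eq(2) by auto
  then show ?thesis by (auto simp: null_cone_def)
qed

definition alternating :: "nat \<Rightarrow> real" where
  "alternating j = (- 1) ^ j"

lemma span_alternating_form_radical:
  assumes "n \<ge> 2"
  shows "span (insert alternating (form_radical (Psi_polar n))) = affine_alternating n"
proof -
  interpret continuous_symmetric_form "Psi_polar n"
    using assms by (rule continuous_symmetric_form_Psi_polar)
  show ?thesis
    unfolding set_eq_iff span_breakdown_eq span_radical
    unfolding form_radical_Psi_polar[OF assms]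
    by (auto simp: alternating_def affine_alternating_def diff_eq_eq)
qed

lemma form_radical_subset_palindromic:
  assumes "n \<ge> 2"
  shows "form_radical (Psi_polar n) \<subseteq> palindromic n"
proof
  fix x assume "x \<in> form_radical (Psi_polar n)"
  then obtain c where "x j = c" if "j \<in> {1..n}" for j
    unfolding form_radical_Psi_polar[OF assms] by blast
  then show "x \<in> palindromic n" by (auto simp: palindromic_def)
qed

lemma null_cone_Int_palindromic_even:
  assumes "n \<ge> 2" "even n"
  shows "null_cone (Psi_polar n) \<inter> palindromic n = form_radical (Psi_polar n)"
proof
  show "null_cone (Psi_polar n) \<inter> palindromic n \<subseteq> form_radical (Psi_polar n)"
  proof
    fix x assume "x \<in> null_cone (Psi_polar n) \<inter> palindromic n"
    then have "x \<in> palindromic n" "x \<in> affine_alternating n"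
      unfolding null_cone_Int_palindromic[OF assms(1)] by simp_all
    then obtain c d where x_eq: "\<And>j. j \<in> {1..n} \<Longrightarrow> x j = c + d * (- 1) ^ j"
      unfolding affine_alternating_def by blast
    have "x 1 = x n" using palindromicD[OF \<open>x \<in> palindromic n\<close>, of 1] assms(1) by simp
    then have "d = 0" using x_eq[of 1] x_eq[of n] assms by simp
    then show "x \<in> form_radical (Psi_polar n)"
      using x_eq by (auto simp: form_radical_Psi_polar[OF assms(1)])
  qed
  show "form_radical (Psi_polar n) \<subseteq> null_cone (Psi_polar n) \<inter> palindromic n"
    using form_radical_subset_palindromic[OF assms(1)]
    by (auto simp: form_radical_def null_cone_def)
qed

lemma null_cone_Int_palindromic_odd:
  assumes "n \<ge> 2" "odd n"
  shows "null_cone (Psi_polar n) \<inter> palindromic n =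
    span (insert alternating (form_radical (Psi_polar n)))"
proof -
  have "(- 1 :: real) ^ (n - s + 1) = (- 1) ^ s" if "s \<in> {1..n}" for s
  proof -
    have "even (n - s + 1) \<longleftrightarrow> even s" using that assms(2) by auto
    then show ?thesis by (metis neg_one_even_power neg_one_odd_power)
  qed
  then have "affine_alternating n \<subseteq> palindromic n"
    by (auto simp: affine_alternating_def palindromic_def)
  then show ?thesis
    unfolding null_cone_Int_palindromic[OF assms(1)] span_alternating_form_radical[OF assms(1)]
    by blast
qed

text \<open>The subtracted mean is hyperbolic on the coordinates \<open>j\<close> and \<open>n - j\<close> for \<open>j = 1, 2\<close>, which
  gives a positive plane. It is diagonal and positive on the last three coordinates, where the
  vectors of mean zero form a negative plane.\<close>

lemma Psi_polar_positive_plane: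
  fixes a b :: real
  assumes "n \<ge> 5" and nonzero: "(a, b) \<noteq> (0, 0)"
  defines "v \<equiv> a *\<^sub>R (\<lambda>_. 0)(1 := 2 - real n, n - 1 := 1)
    + b *\<^sub>R (\<lambda>_. 0)(2 := 2 - real n, n - 2 := 1)"
  shows "Psi_polar n v v > 0"
proof -
  let ?weight = "\<lambda>j. real ((n - 1) choose (j - 1))"
  have v_values: "v 1 = (2 - real n) * a" "v 2 = (2 - real n) * b" "v (n - 2) = b" "v (n - 1) = a"
    and v_zero: "\<And>j. j \<notin> {1, 2, n - 2, n - 1} \<Longrightarrow> v j = 0"
    using \<open>n \<ge> 5\<close> by (auto simp: v_def)
  have peer_values: "peer_mean n v 1 = a" "peer_mean n v 2 = 0" "peer_mean n v (n - 2) = - b"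
    "peer_mean n v (n - 1) = 0"
    using \<open>n \<ge> 5\<close> v_values by (simp_all add: peer_mean_def of_nat_diff field_simps)
  have "binomial_mean n (\<lambda>j. peer_mean n v j * v j) =
      (\<Sum>j\<leftarrow>[1, 2, n - 2, n - 1]. ?weight j * (peer_mean n v j * v j)) / 2 ^ (n - 1)"
    using \<open>n \<ge> 5\<close> v_zero by (intro binomial_mean_supported) auto
  also have "\<dots> = - ((real n - 2) * a\<^sup>2 + ?weight (n - 2) * b\<^sup>2) / 2 ^ (n - 1)"
    by (simp add: v_values[unfolded One_nat_def] peer_values[unfolded One_nat_def]
        power2_eq_square algebra_simps)
  also have "\<dots> < 0"
  proof -
    have "?weight (n - 2) > 0" using \<open>n \<ge> 5\<close> by simp
    then have "(real n - 2) * a\<^sup>2 + ?weight (n - 2) * b\<^sup>2 > 0"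
      using \<open>n \<ge> 5\<close> nonzero by (cases "a = 0") (simp_all add: add_pos_nonneg)
    then show ?thesis by (intro divide_neg_pos) simp_all
  qed
  finally show ?thesis
    unfolding Psi_polar_eq using zero_le_square[of "binomial_mean n v"] by linarith
qed

lemma binomial_mean_supported_last_three:
  assumes "n \<ge> 3" "\<And>j. j \<notin> {n - 2, n - 1, n} \<Longrightarrow> f j = 0"
  shows "binomial_mean n f =
    (real ((n - 1) choose 2) * f (n - 2) + (real n - 1) * f (n - 1) + f n) / 2 ^ (n - 1)"
proof -
  have "(n - 1) choose (n - 3) = (n - 1) choose 2" "(n - 1) choose (n - 2) = n - 1"
    using assms(1) binomial_symmetric[of "2" "n - 1"] binomial_symmetric[of "1" "n - 1"]
    by (simp_all add: numeral_eq_Suc)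
  moreover have "binomial_mean n f =
      (\<Sum>j\<leftarrow>[n - 2, n - 1, n]. real ((n - 1) choose (j - 1)) * f j) / 2 ^ (n - 1)"
    using assms by (intro binomial_mean_supported) auto
  ultimately show ?thesis using assms(1) by (simp add: of_nat_diff numeral_eq_Suc)
qed

lemma Psi_polar_negative_plane:
  fixes a b :: real
  assumes "n \<ge> 5" and nonzero: "(a, b) \<noteq> (0, 0)"
  defines "v \<equiv> a *\<^sub>R (\<lambda>_. 0)(n - 1 := 1, n := 1 - real n)
    + b *\<^sub>R (\<lambda>_. 0)(n - 2 := 1, n := - real ((n - 1) choose 2))"
  shows "Psi_polar n v v < 0"
proof -
  let ?c = "real ((n - 1) choose 2)"
  have v_values: "v (n - 2) = b" "v (n - 1) = a" "v n = (1 - real n) * a - ?c * b"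
    and v_zero: "\<And>j. j \<notin> {n - 2, n - 1, n} \<Longrightarrow> v j = 0"
    using \<open>n \<ge> 5\<close> by (auto simp: v_def)
  have "v 2 = 0" "v 1 = 0" using \<open>n \<ge> 5\<close> by (auto intro!: v_zero)
  then have peer_values: "peer_mean n v (n - 2) = (real n - 3) / (real n - 1) * b"
    "peer_mean n v (n - 1) = (real n - 2) / (real n - 1) * a" "peer_mean n v n = v n"
    using \<open>n \<ge> 5\<close> v_values by (simp_all add: peer_mean_def of_nat_diff field_simps)
  have "binomial_mean n (\<lambda>j. peer_mean n v j * v j) =
      (?c * (peer_mean n v (n - 2) * v (n - 2))
        + (real n - 1) * (peer_mean n v (n - 1) * v (n - 1)) + peer_mean n v n * v n) / 2 ^ (n - 1)"
    using \<open>n \<ge> 5\<close> v_zero by (intro binomial_mean_supported_last_three) simp_all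
  also have "\<dots> =
      (?c * ((real n - 3) / (real n - 1)) * b\<^sup>2 + (real n - 2) * a\<^sup>2 + (v n)\<^sup>2) / 2 ^ (n - 1)"
    unfolding peer_values v_values(1,2) using \<open>n \<ge> 5\<close> by (simp add: power2_eq_square)
  also have "\<dots> > 0"
  proof -
    have "?c * ((real n - 3) / (real n - 1)) > 0" using \<open>n \<ge> 5\<close> by simp
    then have "?c * ((real n - 3) / (real n - 1)) * b\<^sup>2 + (real n - 2) * a\<^sup>2 > 0"
      using \<open>n \<ge> 5\<close> nonzero by (cases "a = 0") (simp_all add: add_nonneg_pos)
    then show ?thesis by (simp add: add_pos_nonneg)
  qed
  finally have "binomial_mean n (\<lambda>j. peer_mean n v j * v j) > 0" .
  moreover have "binomial_mean n v = 0"
    using binomial_mean_supported_last_three[OF _ v_zero] \<open>n \<ge> 5\<close> v_values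
    by (simp add: algebra_simps)
  ultimately show ?thesis by (simp add: Psi_polar_eq)
qed

lemma doubly_indefinite_form_Psi_polar:
  assumes "n \<ge> 5"
  obtains p p' m m' where "doubly_indefinite_form (Psi_polar n) p p' m m'"
proof -
  have "continuous_symmetric_form (Psi_polar n)"
    using assms by (intro continuous_symmetric_form_Psi_polar) simp
  then show ?thesis
    using that Psi_polar_positive_plane[OF assms] Psi_polar_negative_plane[OF assms]
    unfolding doubly_indefinite_form_def doubly_indefinite_form_axioms_def by blast
qed

lemma alternating_null_not_radical:
  assumes "n \<ge> 2" "odd n"
  shows "Psi_polar n alternating alternating = 0" "alternating \<notin> form_radical (Psi_polar n)"
proof -
  have "alternating \<in> null_cone (Psi_polar n)"
    using null_cone_Int_palindromic_odd[OF assms] by (blast intro: span_base)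
  then show "Psi_polar n alternating alternating = 0" by (simp add: null_cone_def)
  have "alternating 1 \<noteq> alternating 2" by (simp add: alternating_def)
  moreover have "1 \<in> {1..n}" "2 \<in> {1..n}" using assms(1) by auto
  ultimately show "alternating \<notin> form_radical (Psi_polar n)"
    unfolding form_radical_Psi_polar[OF assms(1)] by force
qed

theorem connected_null_cone_minus_palindromic:
  assumes "n \<ge> 5"
  shows "connected (null_cone (Psi_polar n) - palindromic n)"
proof -
  obtain p p' m m' where "doubly_indefinite_form (Psi_polar n) p p' m m'"
    using doubly_indefinite_form_Psi_polar[OF assms] .
  then interpret doubly_indefinite_form "Psi_polar n" p p' m m' .
  have "n \<ge> 2" using assms by simp
  have "null_cone (Psi_polar n) - palindromic n =
      null_cone (Psi_polar n) - null_cone (Psi_polar n) \<inter> palindromic n"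
    by blast
  then show ?thesis
    using connected_null_cone_minus_radical null_cone_Int_palindromic_even[OF \<open>n \<ge> 2\<close>]
      connected_null_cone_minus_span[OF alternating_null_not_radical[OF \<open>n \<ge> 2\<close>]]
      null_cone_Int_palindromic_odd[OF \<open>n \<ge> 2\<close>]
    by (cases "even n") simp_all
qed

subsection \<open>Radial clamping to the cube\<close>

definition cube_gauge :: "nat \<Rightarrow> (nat \<Rightarrow> real) \<Rightarrow> real" where
  "cube_gauge n x = max 1 (2 * Max ((\<lambda>i. \<bar>x i - 1 / 2\<bar>) ` {1..n}))"

definition cube_clamp :: "nat \<Rightarrow> (nat \<Rightarrow> real) \<Rightarrow> nat \<Rightarrow> real" where
  "cube_clamp n x = (\<lambda>i\<in>{1..n}. 1 / 2 + (x i - 1 / 2) / cube_gauge n x)"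

lemma cube_gauge_pos: "cube_gauge n x > 0"
  by (simp add: cube_gauge_def)

lemma continuous_on_Max:
  fixes f :: "'i \<Rightarrow> 'a::topological_space \<Rightarrow> 'b::linorder_topology"
  assumes "finite I" "I \<noteq> {}" "\<And>i. i \<in> I \<Longrightarrow> continuous_on S (f i)"
  shows "continuous_on S (\<lambda>x. Max ((\<lambda>i. f i x) ` I))"
  using assms by (induction I rule: finite_ne_induct) (auto intro!: continuous_on_max)

lemma continuous_map_cube_clamp:
  assumes "n \<ge> 1"
  shows "continuous_map euclidean (powertop_real {1..n}) (cube_clamp n)"
  unfolding continuous_map_componentwise
proof (intro conjI ballI)
  show "cube_clamp n ` topspace euclidean \<subseteq> extensional {1..n}"
    by (auto simp: cube_clamp_def)
  fix i assume "i \<in> {1..n}"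
  have "continuous_on UNIV (cube_gauge n)"
    unfolding cube_gauge_def using assms
    by (intro continuous_intros continuous_on_Max) auto
  then have "continuous_on UNIV (\<lambda>x :: nat \<Rightarrow> real. 1 / 2 + (x i - 1 / 2) / cube_gauge n x)"
    by (intro continuous_intros) (simp_all add: cube_gauge_pos less_imp_neq[symmetric])
  then show "continuous_map euclidean euclideanreal (\<lambda>x. cube_clamp n x i)"
    using \<open>i \<in> {1..n}\<close> by (simp add: cube_clamp_def)
qed

lemma cube_clamp_in_unit_cube: "cube_clamp n x \<in> unit_cube n"
proof -
  have "cube_clamp n x i \<in> {0..1}" if "i \<in> {1..n}" for i
  proof -
    have "\<bar>x i - 1 / 2\<bar> \<le> Max ((\<lambda>i. \<bar>x i - 1 / 2\<bar>) ` {1..n})"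
      using that by (intro Max_ge) auto
    then have "\<bar>(x i - 1 / 2) / cube_gauge n x\<bar> \<le> 1 / 2"
      using cube_gauge_pos[of n x] by (simp add: cube_gauge_def field_simps)
    moreover have "cube_clamp n x i = 1 / 2 + (x i - 1 / 2) / cube_gauge n x"
      using that by (simp add: cube_clamp_def)
    ultimately show ?thesis unfolding atLeastAtMost_iff by linarith
  qed
  then show ?thesis by (auto simp: unit_cube_def PiE_iff cube_clamp_def)
qed

lemma cube_clamp_eq_self:
  assumes "n \<ge> 1" "x \<in> unit_cube n"
  shows "cube_clamp n x = x"
proof -
  have "\<bar>x i - 1 / 2\<bar> \<le> 1 / 2" if "i \<in> {1..n}" for i
  proof -
    have "x i \<in> {0..1}" using assms(2) that unfolding unit_cube_def by (rule PiE_mem)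
    then show ?thesis unfolding atLeastAtMost_iff by linarith
  qed
  then have "Max ((\<lambda>i. \<bar>x i - 1 / 2\<bar>) ` {1..n}) \<le> 1 / 2"
    using assms(1) by (intro Max.boundedI) auto
  then have "cube_gauge n x = 1" by (simp add: cube_gauge_def)
  then have "cube_clamp n x = restrict x {1..n}" by (simp add: cube_clamp_def)
  then show ?thesis using assms(2) unfolding unit_cube_def by (metis PiE_restrict)
qed

lemma cube_clamp_in_null_cone_iff:
  assumes "n \<ge> 2"
  shows "cube_clamp n x \<in> null_cone (Psi_polar n) \<longleftrightarrow> x \<in> null_cone (Psi_polar n)"
proof -
  interpret continuous_symmetric_form "Psi_polar n"
    using assms by (rule continuous_symmetric_form_Psi_polar)
  define t where "t = 1 / cube_gauge n x"
  have "cube_clamp n x - t *\<^sub>R x \<in> form_radical (Psi_polar n)"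
    unfolding form_radical_Psi_polar[OF assms] mem_Collect_eq
    by (intro exI[of _ "1 / 2 - t / 2"]) (simp add: cube_clamp_def t_def diff_divide_distrib)
  from form_add_radical[OF this, of "t *\<^sub>R x"]
  have "Psi_polar n (cube_clamp n x) (cube_clamp n x) = t\<^sup>2 * Psi_polar n x x"
    by (simp add: form_simps power2_eq_square)
  moreover have "t \<noteq> 0" using cube_gauge_pos[of n x] by (simp add: t_def)
  ultimately show ?thesis by (simp add: null_cone_def)
qed

lemma cube_clamp_in_palindromic_iff: "cube_clamp n x \<in> palindromic n \<longleftrightarrow> x \<in> palindromic n"
  unfolding palindromic_def mem_Collect_eq
proof (rule ball_cong)
  fix s assume "s \<in> {1..n}"
  then have "s \<in> {1..n}" "n - s + 1 \<in> {1..n}" by auto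
  then show "cube_clamp n x s = cube_clamp n x (n - s + 1) \<longleftrightarrow> x s = x (n - s + 1)"
    using cube_gauge_pos[of n x] by (simp add: cube_clamp_def)
qed simp

lemma GST_eq:
  assumes "n \<ge> 2"
  shows "GST n = unit_cube n \<inter> (null_cone (Psi_polar n) - palindromic n)"
  using Psi_eq_Psi_polar[OF assms]
  by (auto simp: GST_def Ind_def Infl_def null_cone_def palindromic_def)

lemma GST_eq_cube_clamp_image:
  assumes "n \<ge> 2"
  shows "GST n = cube_clamp n ` (null_cone (Psi_polar n) - palindromic n)"
proof (intro equalityI subsetI)
  fix x assume "x \<in> GST n"
  then have "x = cube_clamp n x" "x \<in> null_cone (Psi_polar n) - palindromic n"
    using cube_clamp_eq_self[of n x] assms by (auto simp: GST_eq)
  then show "x \<in> cube_clamp n ` (null_cone (Psi_polar n) - palindromic n)" by (rule image_eqI)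
qed (auto simp: GST_eq cube_clamp_in_unit_cube cube_clamp_in_null_cone_iff
    cube_clamp_in_palindromic_iff assms)

theorem connectedin_GST:
  assumes "n \<ge> 5"
  shows "connectedin (powertop_real {1..n}) (GST n)"
proof -
  have "connectedin (powertop_real {1..n})
      (cube_clamp n ` (null_cone (Psi_polar n) - palindromic n))"
    using assms connected_null_cone_minus_palindromic
    by (intro connectedin_continuous_map_image[OF continuous_map_cube_clamp]) simp_all
  then show ?thesis using assms by (simp add: GST_eq_cube_clamp_image)
qed

theorem mainTheorem1:
  fixes n :: nat
  assumes "n \<in> {5, 6, 7}"
  shows "connectedin (powertop_real {1..n}) (GST n)"
  using assms by (intro connectedin_GST) auto

end
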